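(* Let $\xi,\xi_1,\xi_2,\ldots$ be independent identically distributed random variables taking values in $\{0,1,2,\ldots\}$ with $\mathbf{P}(\xi=i)=p_i>0$ for all $i\ge 0$, $\sum_{i\ge 0}p_i=1$. Let $\bar\xi_n$, $r(n)$, $a_n$ be as defined in the context, and let $m\ge 1$ be a fixed integer. Suppose that $r(n)$ is a monotonic function and $r(n)\to\infty$ as $n\to\infty$. Suppose further that the series $\sum_{k\ge1}\exp(-j\,r(k))$ converges for $j=m$ and diverges for $j=m-1$. Then: (i) $$\mathbf{P}\Big(\limsup_{n\to\infty}(\bar\xi_n-a_n)=m\Big)=1\quad\text{and}\quad \mathbf{P}\Big(\liminf_{n\to\infty}(\bar\xi_n-a_n)=-1\Big)=1;$$ (ii) for every $l\in\{-1,0,1,\ldots,m\}$, $$\mathbf{P}(\bar\xi_n=a_n+l\ \text{ i.o.})=1.$$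
   Context: For the i.i.d. sequence $\xi,\xi_1,\xi_2,\ldots$ set $\bar\xi_n=\max_{1\le i\le n}\xi_i$. For the distribution $(i,p_i)$, $i\ge0$, of $\xi$ define $$R(n)=-\ln\mathbf{P}(\xi\ge n)=-\ln\Big(\sum_{i\ge n}p_i\Big),\quad n\ge 0,\qquad r(n)=R(n)-R(n-1),\quad n\ge 1,$$ $$a_n=\max\Big(k\ge 0:\ \sum_{i\ge k}p_i\ge \frac1n\Big).$$ "i.o." means "infinitely often", i.e. the event occurs for infinitely many $n$. *)

theory Defs
  imports "HOL-Probability.Probability"
begin

definition tail :: "(nat \<Rightarrow> real) \<Rightarrow> nat \<Rightarrow> real"
  where "tail p n = (\<Sum>\<^sub>\<infinity>i\<in>{n..}. p i)"

definition log_tail :: "(nat \<Rightarrow> real) \<Rightarrow> nat \<Rightarrow> real"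
  where "log_tail p n = - ln (tail p n)"

text \<open>Only meaningful for \<open>n \<ge> 1\<close>; subtraction truncates, so the value at \<open>0\<close> is \<open>0\<close>.\<close>

definition log_tail_step :: "(nat \<Rightarrow> real) \<Rightarrow> nat \<Rightarrow> real"
  where "log_tail_step p n = log_tail p n - log_tail p (n - 1)"

text \<open>For a probability distribution \<open>p\<close> with \<open>p i > 0\<close> for all \<open>i\<close>, the set below is finite
  and contains \<open>0\<close> whenever \<open>n \<ge> 1\<close>. The value at \<open>n = 0\<close> is irrelevant.\<close>

definition tail_level :: "(nat \<Rightarrow> real) \<Rightarrow> nat \<Rightarrow> nat"
  where "tail_level p n = Max {k. tail p k \<ge> 1 / real n}"

text \<open>The sequence starts at index \<open>1\<close>, so the value at \<open>n = 0\<close> is irrelevant.\<close>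

definition running_max :: "(nat \<Rightarrow> 'a \<Rightarrow> nat) \<Rightarrow> nat \<Rightarrow> 'a \<Rightarrow> nat"
  where "running_max \<xi> n \<omega> = Max ((\<lambda>i. \<xi> i \<omega>) ` {1..n})"

end

(* Write T k for the tail and q k = T (k + 1) / T k, which decreases to 0. The level a_n is k exactly
   for 1 / T k <= n < 1 / T (k + 1), so the sum over n of P(xi >= a_n + l) is comparable to the sum
   over k of T (k + l) / T (k + 1), that is, of q^(l - 1). The two Borel-Cantelli lemmas applied to
   single observations thus give limsup = m. At n = 1 / T (k + 1) the maximum is below k with
   probability at most exp (- 1 / q k), which is summable, while it is at most k with probability
   bounded away from 0; this gives liminf = -1. All values in between are attained because a_n
   eventually grows by at most one per step. *)
theory Submission
  imports Defs
begin

section \<open>Tail ratios, levels and thresholds\<close>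

text \<open>Everything that the path argument uses about the tail probabilities \<open>T k\<close> =
  P(xi >= k). Since \<open>T (Suc k) / T k\<close> is exp(-r(k + 1)), an increasing r with limit
  infinity becomes a sequence of ratios decreasing to 0.\<close>

locale tail_function =
  fixes T :: "nat \<Rightarrow> real"
  assumes T_0: "T 0 = 1"
    and T_pos: "T k > 0"
    and T_Suc_less: "T (Suc k) < T k"
    and T_lim: "T \<longlonglongrightarrow> 0"
    and ratio_decseq: "decseq (\<lambda>k. T (Suc k) / T k)"
    and ratio_lim: "(\<lambda>k. T (Suc k) / T k) \<longlonglongrightarrow> 0"
begin

text \<open>This is exp(-r(k + 1)), so the two series of the theorem are the sums of
  \<open>q k ^ m\<close> and of \<open>q k ^ (m - 1)\<close>.\<close>

definition q :: "nat \<Rightarrow> real"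
  where "q k = T (Suc k) / T k"

definition level :: "nat \<Rightarrow> nat"
  where "level n = Max {k. T k \<ge> 1 / real n}"

text \<open>The first time n at which the level a_n is at least k; the level equals k for
  \<open>thresh k\<close> <= n < \<open>thresh (Suc k)\<close>.\<close>

definition thresh :: "nat \<Rightarrow> nat"
  where "thresh k = nat \<lceil>1 / T k\<rceil>"

lemma T_antimono: "j \<le> k \<Longrightarrow> T k \<le> T j"
  by (rule decseqD[OF decseq_SucI]) (use T_Suc_less in \<open>auto intro: less_imp_le\<close>)

lemma T_le_1: "T k \<le> 1"
  using T_antimono[of 0 k] by (simp add: T_0)

lemma q_pos: "q k > 0"
  using T_pos by (simp add: q_def)

lemma T_Suc: "T (Suc k) = T k * q k"
  using T_pos[of k] by (simp add: q_def)

lemma q_antimono: "j \<le> k \<Longrightarrow> q k \<le> q j"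
  using ratio_decseq by (auto simp: q_def decseq_def)

lemma q_lim: "q \<longlonglongrightarrow> 0"
  using ratio_lim by (simp add: q_def[abs_def])

lemma eventually_q_le: "e > 0 \<Longrightarrow> eventually (\<lambda>k. q k \<le> e) sequentially"
  by (drule order_tendstoD(2)[OF q_lim]) (auto elim: eventually_mono)

lemma thresh_le_iff: "n \<ge> 1 \<Longrightarrow> thresh k \<le> n \<longleftrightarrow> 1 / real n \<le> T k"
  using T_pos[of k] by (auto simp: thresh_def nat_ceiling_le_eq field_simps)

text \<open>The set under the maximum is finite because \<open>T\<close> tends to 0, contains 0
  because \<open>T 0\<close> = 1, and is downward closed because \<open>T\<close> decreases. Hence k
  lies below its maximum exactly if k belongs to it. All later facts about levels go through this
  equivalence.\<close>

lemma le_level_iff: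
  assumes "n \<ge> 1"
  shows "k \<le> level n \<longleftrightarrow> thresh k \<le> n"
proof -
  let ?S = "{k. T k \<ge> 1 / real n}"
  have "eventually (\<lambda>k. T k < 1 / real n) sequentially"
    using assms by (intro order_tendstoD(2)[OF T_lim]) auto
  then obtain K where K: "\<And>k. k \<ge> K \<Longrightarrow> T k < 1 / real n"
    by (auto simp: eventually_at_top_linorder)
  have "?S \<subseteq> {..<K}" using K by (force simp: not_less[symmetric])
  hence fin: "finite ?S" by (rule finite_subset) simp
  have "0 \<in> ?S" using assms by (simp add: T_0)
  hence ne: "?S \<noteq> {}" by blast
  show ?thesis
    unfolding level_def thresh_le_iff[OF assms] Max_ge_iff[OF fin ne]
    using T_antimono by (auto intro: order_trans)
qed

lemma le_thresh: "1 / T k \<le> real (thresh k)"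
  unfolding thresh_def by (rule real_nat_ceiling_ge)

text \<open>Rounding up adds at most 1, which is at most 1 / \<open>T k\<close>.\<close>

lemma thresh_le: "real (thresh k) \<le> 2 / T k"
proof -
  have "1 \<le> 1 / T k" using T_pos[of k] T_le_1[of k] by simp
  moreover from this have "real (thresh k) \<le> 1 / T k + 1"
    unfolding thresh_def using ceiling_correct[of "1 / T k"] by linarith
  ultimately show ?thesis by (simp add: field_simps)
qed

lemma thresh_0: "thresh 0 = 1"
  by (simp add: thresh_def T_0)

lemma thresh_mono: "j \<le> k \<Longrightarrow> thresh j \<le> thresh k"
  using T_antimono[of j k] T_pos unfolding thresh_def
  by (intro nat_mono ceiling_mono divide_left_mono) auto

lemma thresh_pos: "thresh k \<ge> 1"
  using thresh_mono[of 0 k] by (simp add: thresh_0)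

lemma level_mono: "1 \<le> n \<Longrightarrow> n \<le> n' \<Longrightarrow> level n \<le> level n'"
  using le_level_iff[of n "level n"] le_level_iff[of n' "level n"] by auto

lemma less_thresh_Suc_level: "n \<ge> 1 \<Longrightarrow> n < thresh (Suc (level n))"
  using le_level_iff[of n "Suc (level n)"] by auto

lemma level_thresh: "k \<le> level (thresh k)"
  using le_level_iff[of "thresh k" k] thresh_pos by auto

lemma filterlim_level: "filterlim level at_top sequentially"
  unfolding filterlim_at_top
proof
  fix k
  show "eventually (\<lambda>n. k \<le> level n) sequentially"
    using eventually_ge_at_top[of "thresh k"]
  proof eventually_elim
    case (elim n)
    thus ?case using le_level_iff[of n k] thresh_pos[of k] by auto
  qed
qed

text \<open>For k = \<open>level n\<close> one has \<open>T (Suc k)\<close> < 1/n. Once the ratios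
  are at most 1/2, the next tail is below 1/(2n) <= 1/(n + 1), so level k + 2 is not yet reached at
  time n + 1.\<close>

lemma eventually_level_Suc: "eventually (\<lambda>n. level (Suc n) \<le> Suc (level n)) sequentially"
proof -
  have "eventually (\<lambda>n. q (level n) \<le> 1 / 2) sequentially"
    by (rule eventually_compose_filterlim[OF eventually_q_le filterlim_level]) simp
  with eventually_ge_at_top[of 1] show ?thesis
  proof eventually_elim
    case (elim n)
    let ?k = "level n"
    have "T (Suc ?k) < 1 / real n"
      using less_thresh_Suc_level[of n] thresh_le_iff[of n "Suc ?k"] elim by auto
    moreover have "q (Suc ?k) \<le> 1 / 2"
      using q_antimono[of ?k "Suc ?k"] elim by simp
    ultimately have "T (Suc (Suc ?k)) < 1 / real n * (1 / 2)"
      unfolding T_Suc[of "Suc ?k"] by (intro mult_less_le_imp_less) (auto simp: T_pos q_pos less_imp_le)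
    also have "\<dots> \<le> 1 / real (Suc n)" using elim by (simp add: field_simps)
    finally have "\<not> Suc (Suc ?k) \<le> level (Suc n)"
      using le_level_iff[of "Suc n" "Suc (Suc ?k)"] thresh_le_iff[of "Suc n" "Suc (Suc ?k)"] by auto
    thus ?case by simp
  qed
qed

section \<open>Comparison of sums over times with sums over levels\<close>

text \<open>The quotient \<open>T (k + d) / T k\<close> is a product of d consecutive ratios. By
  monotonicity each is at most \<open>q k\<close> and, for the companion bound that follows, at
  least \<open>q (k + d)\<close>.\<close>

lemma T_add_le: "T (k + d) \<le> T k * q k ^ d"
proof (induction d)
  case (Suc d)
  have "T (k + d) * q (k + d) \<le> T k * q k ^ d * q k"
    using Suc q_antimono[of k "k + d"] by (intro mult_mono) (auto simp: q_pos T_pos less_imp_le)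
  thus ?case by (simp add: T_Suc mult_ac)
qed simp

lemma le_T_add: "T k * q (k + d) ^ d \<le> T (k + d)"
proof (induction d)
  case (Suc d)
  have "T k * q (k + Suc d) ^ d * q (k + Suc d) \<le> T k * q (k + d) ^ d * q (k + d)"
    using q_antimono[of "k + d" "k + Suc d"]
    by (intro mult_mono power_mono mult_nonneg_nonneg zero_le_power) (auto simp: q_pos T_pos less_imp_le)
  also have "\<dots> \<le> T (k + d) * q (k + d)"
    using Suc by (intro mult_right_mono) (auto simp: q_pos less_imp_le)
  finally show ?case by (simp add: T_Suc mult_ac)
qed simp

lemma level_eqI: "thresh k \<le> n \<Longrightarrow> n < thresh (Suc k) \<Longrightarrow> level n = k"
  using le_level_iff[of n k] le_level_iff[of n "Suc k"] thresh_pos[of k] by auto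

text \<open>Grouping of times by their level: level k occupies \<open>thresh (Suc k)\<close> -
  \<open>thresh k\<close> times. Times start at 1 and i at 0, hence \<open>Suc i\<close> and the
  upper end \<open>thresh K - 1\<close>.\<close>

lemma sum_level:
  fixes f :: "nat \<Rightarrow> real"
  shows "(\<Sum>i<thresh K - 1. f (level (Suc i)))
       = (\<Sum>k<K. (real (thresh (Suc k)) - real (thresh k)) * f k)"
proof (induction K)
  case 0
  thus ?case by (simp add: thresh_0)
next
  case (Suc K)
  have le: "thresh K - 1 \<le> thresh (Suc K) - 1"
    using thresh_mono[of K "Suc K"] by simp
  have "(\<Sum>i = thresh K - 1..<thresh (Suc K) - 1. f (level (Suc i)))
      = (\<Sum>i = thresh K - 1..<thresh (Suc K) - 1. f K)"
    by (intro sum.cong refl arg_cong[where f = f] level_eqI) (use thresh_pos[of K] in auto)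
  also have "\<dots> = (real (thresh (Suc K)) - real (thresh K)) * f K"
    using thresh_pos[of K] thresh_mono[of K "Suc K"] by (simp add: of_nat_diff)
  finally show ?case
    using Suc sum.atLeastLessThan_concat[of 0 "thresh K - 1" "thresh (Suc K) - 1" "\<lambda>i. f (level (Suc i))"] le
    by (simp add: lessThan_atLeast0)
qed

lemma summable_level_iff:
  fixes f :: "nat \<Rightarrow> real"
  assumes f: "\<And>k. f k \<ge> 0"
  shows "summable (\<lambda>i. f (level (Suc i)))
     \<longleftrightarrow> summable (\<lambda>k. (real (thresh (Suc k)) - real (thresh k)) * f k)"
    (is "summable ?F \<longleftrightarrow> summable ?G")
proof
  have G: "?G k \<ge> 0" for k using thresh_mono[of k "Suc k"] f by simp
  { assume F: "summable ?F"
    show "summable ?G"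
      by (rule summableI_nonneg_bounded[OF G], subst sum_level[symmetric])
         (rule sum_le_suminf[OF F], use f in auto) }
  { assume sG: "summable ?G"
    show "summable ?F"
    proof (rule summableI_nonneg_bounded)
      fix n
      let ?K = "Suc (level (Suc n))"
      have "n \<le> thresh ?K - 1" using less_thresh_Suc_level[of "Suc n"] by simp
      hence "sum ?F {..<n} \<le> sum ?F {..<thresh ?K - 1}"
        using f by (intro sum_mono2) auto
      also have "\<dots> = sum ?G {..<?K}" by (rule sum_level)
      also have "\<dots> \<le> suminf ?G" by (rule sum_le_suminf[OF sG]) (use G in auto)
      finally show "sum ?F {..<n} \<le> suminf ?G" .
    qed (rule f) }
qed

text \<open>Level k lasts at most 2 / \<open>T (Suc k)\<close> steps and each contributes at most
  \<open>T (Suc k) * q (Suc k) ^ m\<close>, so the whole level contributes at most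
  \<open>2 * q (Suc k) ^ m\<close>.\<close>

lemma summable_T_level:
  assumes "summable (\<lambda>k. q k ^ m)"
  shows "summable (\<lambda>i. T (level (Suc i) + m + 1))"
proof -
  have "summable (\<lambda>k. (real (thresh (Suc k)) - real (thresh k)) * T (k + m + 1))"
  proof (rule summable_comparison_test)
    have "summable (\<lambda>k. q (Suc k) ^ m)" by (subst summable_Suc_iff) (rule assms)
    thus "summable (\<lambda>k. 2 * q (Suc k) ^ m)" by (rule summable_mult)
    show "\<exists>N. \<forall>k\<ge>N. norm ((real (thresh (Suc k)) - real (thresh k)) * T (k + m + 1)) \<le> 2 * q (Suc k) ^ m"
    proof (intro exI allI impI)
      fix k :: nat
      have "(real (thresh (Suc k)) - real (thresh k)) * T (k + m + 1) \<le> 2 / T (Suc k) * (T (Suc k) * q (Suc k) ^ m)"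
        using thresh_le[of "Suc k"] T_add_le[of "Suc k" m]
        by (intro mult_mono) (auto simp: T_pos less_imp_le)
      thus "norm ((real (thresh (Suc k)) - real (thresh k)) * T (k + m + 1)) \<le> 2 * q (Suc k) ^ m"
        using T_pos[of "Suc k"] T_pos[of "k + m + 1"] thresh_mono[of k "Suc k"] by simp
    qed
  qed
  thus ?thesis by (subst summable_level_iff[of "\<lambda>k. T (k + m + 1)"]) (auto simp: T_pos less_imp_le)
qed

text \<open>For large k, level k lasts at least 1 / (2 \<open>T (Suc k)\<close>) steps and each
  contributes at least \<open>T (Suc k) * q (k + m) ^ (m - 1)\<close>. Shifting the index by m does
  not affect divergence.\<close>

lemma not_summable_T_level:
  assumes "\<not> summable (\<lambda>k. q k ^ (m - 1))" "m \<ge> 1"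
  shows "\<not> summable (\<lambda>i. T (level (Suc i) + m))"
proof
  assume "summable (\<lambda>i. T (level (Suc i) + m))"
  hence "summable (\<lambda>k. (real (thresh (Suc k)) - real (thresh k)) * T (k + m))"
    by (subst (asm) summable_level_iff[of "\<lambda>k. T (k + m)"]) (auto simp: T_pos less_imp_le)
  hence "summable (\<lambda>k. 2 * ((real (thresh (Suc k)) - real (thresh k)) * T (k + m)))"
    by (rule summable_mult)
  hence "summable (\<lambda>k. q (k + m) ^ (m - 1))"
  proof (rule summable_comparison_test_ev[rotated])
    show "eventually (\<lambda>k. norm (q (k + m) ^ (m - 1)) \<le>
            2 * ((real (thresh (Suc k)) - real (thresh k)) * T (k + m))) sequentially"
      \<comment> \<open>With \<open>q k\<close> <= 1/4, the bound 2 / \<open>T k\<close> on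
        \<open>thresh k\<close> is at most half of 1 / \<open>T (Suc k)\<close>, so subtracting it
        leaves at least the other half.\<close>
      using eventually_q_le[of "1/4", simplified]
    proof eventually_elim
      case (elim k)
      have "T (Suc k) \<le> T k * (1/4)"
        unfolding T_Suc using elim T_pos[of k] by (intro mult_left_mono) auto
      hence "2 / T k \<le> (1 / 2) / T (Suc k)"
        using T_pos[of k] T_pos[of "Suc k"] by (simp add: field_simps)
      hence "(1 / 2) / T (Suc k) \<le> 1 / T (Suc k) - 2 / T k"
        using T_pos[of "Suc k"] by (simp add: field_simps)
      also have "\<dots> \<le> real (thresh (Suc k)) - real (thresh k)"
        using le_thresh[of "Suc k"] thresh_le[of k] by simp
      finally have "(1 / 2) / T (Suc k) * (T (Suc k) * q (k + m) ^ (m - 1)) \<le>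
          (real (thresh (Suc k)) - real (thresh k)) * T (k + m)"
        using le_T_add[of "Suc k" "m - 1"] assms(2) thresh_mono[of k "Suc k"]
        by (intro mult_mono) (auto simp: T_pos q_pos less_imp_le)
      thus ?case using T_pos[of "Suc k"] q_pos[of "k + m"] by (simp add: less_imp_le)
    qed
  qed
  with assms(1) show False
    using summable_iff_shift[of "\<lambda>k. q k ^ (m - 1)" m] by simp
qed

section \<open>Deterministic argument along a single path\<close>

text \<open>Since \<open>level\<close> grows by at most one per step, the difference below never jumps downwards
  by more than one, so it passes through every intermediate value on its way down.\<close>

lemma attains_between:
  fixes x :: "nat \<Rightarrow> nat"
  defines "D \<equiv> \<lambda>n. int (Max (x ` {..<n})) - int (level n)"
  assumes hi: "\<exists>\<^sub>\<infinity>n. D n \<ge> b" and lo: "\<exists>\<^sub>\<infinity>n. D n \<le> a" and l: "a \<le> l" "l \<le> b"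
  shows "\<exists>\<^sub>\<infinity>n. D n = l"
  unfolding INFM_nat_le
proof
  fix N0
  obtain N1 where N1: "\<And>n. n \<ge> N1 \<Longrightarrow> level (Suc n) \<le> Suc (level n)"
    using eventually_level_Suc by (auto simp: eventually_at_top_linorder)
  \<comment> \<open>The entry 1 ensures that the maxima from N on are taken over non-empty
    sets.\<close>
  define N where "N = Max {N0, N1, 1}"
  obtain s where s: "s \<ge> N" "D s \<ge> b" using hi by (auto simp: INFM_nat_le)
  obtain t where t: "t \<ge> s" "D t \<le> a" using lo by (auto simp: INFM_nat_le)
  have step: "D n - 1 \<le> D (Suc n)" if "n \<ge> s" for n
  proof -
    have "n \<ge> N1" "n \<ge> 1" using that s by (auto simp: N_def)
    have "Max (x ` {..<n}) \<le> Max (x ` {..<Suc n})"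
      using \<open>n \<ge> 1\<close> by (intro Max_mono) (auto simp: lessThan_empty_iff)
    thus ?thesis using N1[OF \<open>n \<ge> N1\<close>] by (simp add: D_def)
  qed
  \<comment> \<open>The first time from s on at which the difference is at most l. Either u = s,
    where the difference is also at least b >= l, or it exceeded l one step earlier and dropped by
    at most one.\<close>
  define u where "u = (LEAST n. n \<ge> s \<and> D n \<le> l)"
  have u: "u \<ge> s \<and> D u \<le> l" unfolding u_def
    by (rule LeastI[of _ t]) (use t l in auto)
  have "D u = l"
  proof (cases "u = s")
    case True
    thus ?thesis using u s l by auto
  next
    case False
    then obtain v where v: "u = Suc v" "v \<ge> s" using u by (cases u) auto
    have "\<not> (v \<ge> s \<and> D v \<le> l)"
      by (rule not_less_Least) (use v in \<open>simp add: u_def[symmetric]\<close>)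
    thus ?thesis using step[OF v(2)] v u by auto
  qed
  thus "\<exists>n\<ge>N0. D n = l" using u s by (intro exI[of _ u]) (auto simp: N_def)
qed

text \<open>The four hypotheses are path properties that are later shown to hold almost surely.
  \<open>x i\<close> is the observation number i + 1, hence \<open>level (Suc i)\<close> and the
  maximum over \<open>{..<n}\<close>. For the lower bound, an observation of at least k before
  \<open>thresh (Suc k)\<close> keeps the maximum at least k as long as the level is k + 1.\<close>

lemma max_minus_level:
  fixes x :: "nat \<Rightarrow> nat"
  defines "D \<equiv> \<lambda>n. int (Max (x ` {..<n})) - int (level n)"
  assumes up: "eventually (\<lambda>i. x i < level (Suc i) + m + 1) sequentially"
    and up_io: "\<exists>\<^sub>\<infinity>i. level (Suc i) + m \<le> x i"
    and low: "eventually (\<lambda>k. \<exists>i<thresh (Suc k). k \<le> x i) sequentially"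
    and low_io: "\<exists>\<^sub>\<infinity>k. \<forall>i<thresh (Suc k). x i \<le> k"
  shows "eventually (\<lambda>n. D n \<le> int m) sequentially"
    and "eventually (\<lambda>n. D n \<ge> -1) sequentially"
    and "\<And>l. l \<in> {-1..int m} \<Longrightarrow> \<exists>\<^sub>\<infinity>n. D n = l"
proof -
  obtain I where I: "\<And>i. i \<ge> I \<Longrightarrow> x i < level (Suc i) + m + 1"
    using up by (auto simp: eventually_at_top_linorder)
  \<comment> \<open>The early observations, not covered by \<open>up\<close>, are bounded by a
    constant that the level eventually exceeds.\<close>
  define C where "C = Max (x ` {..I})"
  have C: "x i \<le> C" if "i \<le> I" for i
    unfolding C_def using that by (intro Max_ge) auto
  have "eventually (\<lambda>n. C \<le> level n) sequentially"
    using filterlim_level by (auto simp: filterlim_at_top)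
  with eventually_ge_at_top[of 1] show "eventually (\<lambda>n. D n \<le> int m) sequentially"
  proof eventually_elim
    case (elim n)
    have "x i \<le> level n + m" if "i < n" for i
    proof (cases "i \<le> I")
      case True
      thus ?thesis using C[of i] elim by simp
    next
      case False
      hence "x i \<le> level (Suc i) + m" using I[of i] by simp
      also have "level (Suc i) \<le> level n" using that by (intro level_mono) auto
      finally show ?thesis by simp
    qed
    hence "Max (x ` {..<n}) \<le> level n + m"
      using elim by (subst Max_le_iff) (auto simp: lessThan_empty_iff)
    thus ?case by (simp add: D_def)
  qed
  obtain K where K: "\<And>k. k \<ge> K \<Longrightarrow> \<exists>i<thresh (Suc k). k \<le> x i"
    using low by (auto simp: eventually_at_top_linorder)
  have "eventually (\<lambda>n. Suc K \<le> level n) sequentially"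
    using filterlim_level by (auto simp: filterlim_at_top)
  with eventually_ge_at_top[of 1] show "eventually (\<lambda>n. D n \<ge> -1) sequentially"
  proof eventually_elim
    case (elim n)
    then obtain k where k: "level n = Suc k" "k \<ge> K" by (cases "level n") auto
    from K[OF k(2)] obtain i where i: "i < thresh (Suc k)" "k \<le> x i" by blast
    have "thresh (Suc k) \<le> n" using le_level_iff[of n "Suc k"] k elim by simp
    hence "x i \<le> Max (x ` {..<n})" using i by (intro Max_ge) auto
    thus ?case using i k by (simp add: D_def)
  qed
  have hi: "\<exists>\<^sub>\<infinity>n. D n \<ge> int m"
    unfolding INFM_nat_le
  proof
    fix N
    obtain i where i: "i \<ge> N" "level (Suc i) + m \<le> x i"
      using up_io by (auto simp: INFM_nat_le)
    have "x i \<le> Max (x ` {..<Suc i})" by (intro Max_ge) auto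
    hence "D (Suc i) \<ge> int m" using i unfolding D_def by linarith
    with i show "\<exists>n\<ge>N. D n \<ge> int m" by (intro exI[of _ "Suc i"]) simp
  qed
  have lo: "\<exists>\<^sub>\<infinity>n. D n \<le> -1"
    unfolding INFM_nat_le
  proof
    fix N
    \<comment> \<open>Taking k at least \<open>level (Suc N)\<close> pushes
      \<open>thresh (Suc k)\<close> beyond N. At that time the level is at least k + 1 while the
      maximum is still at most k.\<close>
    obtain k where k: "k \<ge> level (Suc N)" "\<forall>i<thresh (Suc k). x i \<le> k"
      using low_io by (auto simp: INFM_nat_le)
    let ?n = "thresh (Suc k)"
    have "Suc N < thresh (Suc (level (Suc N)))" by (rule less_thresh_Suc_level) simp
    also have "\<dots> \<le> ?n" using k by (intro thresh_mono) simp
    finally have N: "N \<le> ?n" by simp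
    have "Max (x ` {..<?n}) \<le> k"
      using k thresh_pos[of "Suc k"] by (subst Max_le_iff) (auto simp: lessThan_empty_iff)
    with level_thresh[of "Suc k"] N show "\<exists>n\<ge>N. D n \<le> -1"
      by (intro exI[of _ ?n]) (auto simp: D_def)
  qed
  show "\<And>l. l \<in> {-1..int m} \<Longrightarrow> \<exists>\<^sub>\<infinity>n. D n = l"
    using attains_between[of "int m" x "-1"] hi lo by (auto simp: D_def)
qed

end


section \<open>Independence and the Borel-Cantelli lemmas\<close>

text \<open>Independence is a condition on finite subfamilies, and injectivity matches those indexed
  by J with those indexed by the image of J. This serves to renumber the observations from
  0.\<close>

lemma (in prob_space) indep_sets_reindex:
  assumes inj: "inj_on f I" and indep: "indep_sets F (f ` I)"
  shows "indep_sets (\<lambda>i. F (f i)) I"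
proof (rule indep_setsI)
  show "F (f i) \<subseteq> events" if "i \<in> I" for i
    using indep that by (auto simp: indep_sets_def)
  fix A J assume J: "J \<noteq> {}" "J \<subseteq> I" "finite J" "\<forall>j\<in>J. A j \<in> F (f j)"
  have inj': "inj_on f J" using inj J(2) by (rule inj_on_subset)
  define B where "B = A \<circ> inv_into J f"
  have B: "B (f j) = A j" if "j \<in> J" for j
    using that inj' by (simp add: B_def)
  have "prob (\<Inter>i\<in>f ` J. B i) = (\<Prod>i\<in>f ` J. prob (B i))"
    by (rule indep_setsD[OF indep]) (use J B in auto)
  thus "prob (\<Inter>j\<in>J. A j) = (\<Prod>j\<in>J. prob (A j))"
    using B by (simp add: prod.reindex[OF inj'])
qed

lemma (in prob_space) indep_vars_reindex:
  assumes "inj_on f I" "indep_vars N X (f ` I)"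
  shows "indep_vars (\<lambda>i. N (f i)) (\<lambda>i. X (f i)) I"
  using assms indep_sets_reindex[OF assms(1), of "\<lambda>i. {X i -` A \<inter> space M |A. A \<in> sets (N i)}"]
  by (simp add: indep_vars_def2)

text \<open>Single events are trivially stable under intersection, so the sigma-algebras they
  generate are independent, and these contain the complements.\<close>

lemma (in prob_space) indep_events_compl:
  assumes "indep_events A I"
  shows "indep_events (\<lambda>i. space M - A i) I"
proof -
  have A: "A i \<in> events" if "i \<in> I" for i
    using assms that by (auto simp: indep_events_def)
  have "indep_sets (\<lambda>i. sigma_sets (space M) {A i}) I"
    using assms by (intro indep_sets_sigma) (auto simp: indep_events_def_alt Int_stable_def)
  thus ?thesis
    unfolding indep_events_def_alt
    by (rule indep_sets_mono_sets) (auto intro: sigma_sets.Compl)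
qed

text \<open>The second Borel-Cantelli lemma. By 1 - x <= exp(-x), the probability that no event
  occurs from N on is at most exp of minus any partial sum; were it positive, its logarithm would
  bound all partial sums.\<close>

lemma (in prob_space) borel_cantelli_AE2:
  fixes P :: "nat \<Rightarrow> 'a \<Rightarrow> bool"
  assumes indep: "indep_events (\<lambda>n. {\<omega> \<in> space M. P n \<omega>}) UNIV"
    and div: "\<not> summable (\<lambda>n. prob {\<omega> \<in> space M. P n \<omega>})"
  shows "AE \<omega> in M. \<exists>\<^sub>\<infinity>n. P n \<omega>"
proof -
  let ?A = "\<lambda>n. {\<omega> \<in> space M. P n \<omega>}"
  have [measurable]: "Measurable.pred M (P n)" for n
    using indep by (auto simp: indep_events_def pred_def)
  have "AE \<omega> in M. \<exists>n\<ge>N. P n \<omega>" for N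
  proof -
    define B where "B = {\<omega> \<in> space M. \<forall>n\<ge>N. \<not> P n \<omega>}"
    have [measurable]: "B \<in> sets M" unfolding B_def by measurable
    have bound: "prob B \<le> exp (- (\<Sum>n<L. prob (?A (n + N))))" for L
    \<comment> \<open>The product formula is available for non-empty index sets only; for L = 0 the
      bound is 1.\<close>
    proof (cases "L = 0")
      case False
      have "prob B \<le> prob (\<Inter>n\<in>{N..<L + N}. space M - ?A n)"
        using False by (intro finite_measure_mono) (auto simp: B_def)
      also have "\<dots> = (\<Prod>n\<in>{N..<L + N}. prob (space M - ?A n))"
        using indep_events_compl[OF indep] False by (auto simp: indep_events_def)
      also have "\<dots> = (\<Prod>n\<in>{N..<L + N}. 1 - prob (?A n))"
        by (intro prod.cong refl prob_compl) measurable
      also have "\<dots> \<le> (\<Prod>n\<in>{N..<L + N}. exp (- prob (?A n)))"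
        using exp_ge_add_one_self[of "- prob (?A n)" for n] by (intro prod_mono) auto
      also have "\<dots> = exp (- (\<Sum>n\<in>{N..<L + N}. prob (?A n)))"
        by (simp add: exp_sum sum_negf[symmetric])
      also have "(\<Sum>n\<in>{N..<L + N}. prob (?A n)) = (\<Sum>n<L. prob (?A (n + N)))"
        using sum.shift_bounds_nat_ivl[of "\<lambda>n. prob (?A n)" 0 N L] by (simp add: lessThan_atLeast0)
      finally show ?thesis .
    qed simp
    have "prob B = 0"
    proof (rule ccontr)
      assume "prob B \<noteq> 0"
      hence pos: "prob B > 0" by (simp add: zero_less_measure_iff)
      have "summable (\<lambda>n. prob (?A (n + N)))"
      proof (rule summableI_nonneg_bounded)
        fix L
        have "ln (prob B) \<le> - (\<Sum>n<L. prob (?A (n + N)))"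
          using bound[of L] pos ln_mono by fastforce
        thus "(\<Sum>n<L. prob (?A (n + N))) \<le> - ln (prob B)" by simp
      qed simp
      with div show False by (subst (asm) summable_iff_shift[of "\<lambda>n. prob (?A n)"]) simp
    qed
    hence "AE \<omega> in M. \<omega> \<notin> B" by (intro AE_not_in) (simp add: null_sets_def emeasure_eq_measure)
    thus ?thesis by (rule AE_mp) (auto simp: B_def intro!: AE_I2)
  qed
  hence "AE \<omega> in M. \<forall>N. \<exists>n\<ge>N. P n \<omega>" by (simp add: AE_all_countable)
  thus ?thesis by (simp add: INFM_nat_le)
qed

lemma (in prob_space) borel_cantelli_AE1_pred:
  fixes P :: "nat \<Rightarrow> 'a \<Rightarrow> bool"
  assumes [measurable]: "\<And>n. Measurable.pred M (P n)"
    and "summable (\<lambda>n. prob {\<omega> \<in> space M. P n \<omega>})"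
  shows "AE \<omega> in M. eventually (\<lambda>n. \<not> P n \<omega>) sequentially"
proof -
  have "AE \<omega> in M. eventually (\<lambda>n. \<omega> \<in> space M - {\<omega> \<in> space M. P n \<omega>}) sequentially"
    using assms(2) by (intro borel_cantelli_AE1) (auto simp: less_top[symmetric])
  thus ?thesis by (rule AE_mp) (auto intro!: AE_I2 elim: eventually_mono)
qed

section \<open>Almost sure behaviour of the observations\<close>

text \<open>Observations are numbered from 0, so \<open>X i\<close> stands for the observation with
  index i + 1 in the theorem.\<close>

locale iid_tail = prob_space M + tail_function T for M :: "'a measure" and T +
  fixes X :: "nat \<Rightarrow> 'a \<Rightarrow> nat"
  assumes indep: "indep_vars (\<lambda>_. count_space UNIV) X UNIV"
    and prob_ge: "prob {\<omega> \<in> space M. k \<le> X i \<omega>} = T k"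
begin

lemma X_measurable [measurable]: "X i \<in> measurable M (count_space UNIV)"
  using indep by (simp add: indep_vars_def)

lemma indep_events_X: "indep_events (\<lambda>i. {\<omega> \<in> space M. P i (X i \<omega>)}) UNIV"
  by (rule indep_eventsI_indep_vars[OF indep]) simp

lemma prob_less: "prob {\<omega> \<in> space M. X i \<omega> < k} = 1 - T k"
proof -
  have "prob {\<omega> \<in> space M. \<not> k \<le> X i \<omega>} = 1 - T k"
    by (subst prob_neg) (auto simp: prob_ge)
  thus ?thesis by (simp add: not_le)
qed

lemma prob_all_less:
  assumes "finite J"
  shows "prob {\<omega> \<in> space M. \<forall>i\<in>J. X i \<omega> < k} = (1 - T k) ^ card J"
proof (cases "J = {}")
  case False
  hence "{\<omega> \<in> space M. \<forall>i\<in>J. X i \<omega> < k} = (\<Inter>i\<in>J. {\<omega> \<in> space M. X i \<omega> < k})" by auto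
  also have "prob \<dots> = (\<Prod>i\<in>J. prob {\<omega> \<in> space M. X i \<omega> < k})"
    using indep_events_X[of "\<lambda>_ x. x < k"] assms False by (auto simp: indep_events_def)
  finally show ?thesis by (simp add: prob_less)
qed (simp add: prob_space)

lemma AE_upper:
  assumes "summable (\<lambda>k. q k ^ m)"
  shows "AE \<omega> in M. eventually (\<lambda>i. X i \<omega> < level (Suc i) + m + 1) sequentially"
proof -
  have "AE \<omega> in M. eventually (\<lambda>i. \<not> level (Suc i) + m + 1 \<le> X i \<omega>) sequentially"
    using summable_T_level[OF assms] by (intro borel_cantelli_AE1_pred) (auto simp: prob_ge)
  thus ?thesis by (simp add: not_le)
qed

lemma AE_upper_attained:
  assumes "\<not> summable (\<lambda>k. q k ^ (m - 1))" "m \<ge> 1"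
  shows "AE \<omega> in M. \<exists>\<^sub>\<infinity>i. level (Suc i) + m \<le> X i \<omega>"
  using not_summable_T_level[OF assms] by (intro borel_cantelli_AE2 indep_events_X) (simp add: prob_ge)

text \<open>At least 1 / \<open>T (Suc k)\<close> observations precede
  \<open>thresh (Suc k)\<close>, so all are below k with probability at most exp(-1 /
  \<open>q k\<close>). This is dominated by a multiple of \<open>q k ^ m\<close>, and the first
  Borel-Cantelli lemma applies.\<close>

lemma AE_lower:
  assumes sum: "summable (\<lambda>k. q k ^ m)" and m: "m \<ge> 1"
  shows "AE \<omega> in M. eventually (\<lambda>k. \<exists>i<thresh (Suc k). k \<le> X i \<omega>) sequentially"
proof -
  have bound: "prob {\<omega> \<in> space M. \<forall>i\<in>{..<thresh (Suc k)}. X i \<omega> < k} \<le> real m ^ m * q k ^ m" for k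
  proof -
    have "(1 - T k) ^ thresh (Suc k) \<le> exp (- T k) ^ thresh (Suc k)"
      using exp_ge_add_one_self[of "- T k"] T_le_1[of k] by (intro power_mono) auto
    also have "\<dots> = exp (- (T k * thresh (Suc k)))"
      by (simp add: exp_of_nat_mult[symmetric] mult.commute)
    also have "\<dots> \<le> exp (- (1 / q k))"
      using mult_left_mono[OF le_thresh[of "Suc k"], of "T k"] T_pos[of k] by (simp add: q_def)
    \<comment> \<open>With x = 1 / \<open>q k\<close>, exp(x) >= (1 + x/m)^m >= (x/m)^m.\<close>
    also have "exp (- (1 / q k)) \<le> real m ^ m * q k ^ m"
    proof -
      have "(1 / q k / m) ^ m \<le> (1 + 1 / q k / m) ^ m"
        using q_pos[of k] by (intro power_mono) auto
      also have "\<dots> \<le> exp (1 / q k)"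
        using q_pos[of k] m by (intro exp_ge_one_plus_x_over_n_power_n) (auto intro: order_trans[of _ 0])
      finally show ?thesis
        using q_pos[of k] m by (simp add: exp_minus field_simps)
    qed
    finally show ?thesis by (simp add: prob_all_less)
  qed
  have "summable (\<lambda>k. prob {\<omega> \<in> space M. \<forall>i\<in>{..<thresh (Suc k)}. X i \<omega> < k})"
    by (rule summable_comparison_test'[OF summable_mult[OF sum, of "real m ^ m"], of 0])
       (use bound in simp)
  hence "AE \<omega> in M. eventually (\<lambda>k. \<not> (\<forall>i\<in>{..<thresh (Suc k)}. X i \<omega> < k)) sequentially"
    by (intro borel_cantelli_AE1_pred) auto
  thus ?thesis by (rule AE_mp) (auto intro!: AE_I2 elim!: eventually_mono simp: not_less)
qed

text \<open>Along a sparse subsequence \<open>s\<close> the observations before \<open>thresh (s j)\<close> are negligible, which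
  leaves disjoint blocks of observations and hence independent events.\<close>

lemma AE_lower_attained: "AE \<omega> in M. \<exists>\<^sub>\<infinity>k. \<forall>i<thresh (Suc k). X i \<omega> \<le> k"
proof -
  \<comment> \<open>The bound on \<open>q (s j)\<close> makes exceedances before the blocks
    summable, the bound 1/2 on the tail allows 1 - t >= exp(-2t), and strict growth of s makes the
    blocks disjoint.\<close>
  have "\<exists>s::nat \<Rightarrow> nat. \<forall>j. (q (s j) \<le> (1/2) ^ j \<and> T (Suc (s j)) \<le> 1/2) \<and> s j < s (Suc j)"
  proof (rule dependent_nat_choice)
    have ev: "eventually (\<lambda>k. q k \<le> (1/2) ^ j \<and> T (Suc k) \<le> 1/2 \<and> n < k) sequentially" for j n :: nat
    proof (intro eventually_conj)
      show "eventually (\<lambda>k. q k \<le> (1/2) ^ j) sequentially" by (rule eventually_q_le) simp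
      have "(\<lambda>k. T (Suc k)) \<longlonglongrightarrow> 0" using T_lim by (rule LIMSEQ_Suc)
      hence "eventually (\<lambda>k. T (Suc k) < 1/2) sequentially" by (rule order_tendstoD) simp
      thus "eventually (\<lambda>k. T (Suc k) \<le> 1/2) sequentially" by eventually_elim simp
      show "eventually (\<lambda>k. n < k) sequentially" by (rule eventually_gt_at_top)
    qed
    show "\<exists>k. q k \<le> (1/2) ^ 0 \<and> T (Suc k) \<le> 1/2"
      using eventually_happens'[OF _ ev[of 0 0]] by auto
    show "\<exists>k. (q k \<le> (1/2) ^ Suc j \<and> T (Suc k) \<le> 1/2) \<and> n < k" for n j
      using eventually_happens'[OF _ ev[of "Suc j" n]] by auto
  qed
  then obtain s where s: "\<And>j. q (s j) \<le> (1/2) ^ j" "\<And>j. T (Suc (s j)) \<le> 1/2"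
    and "\<And>j. s j < s (Suc j)" by blast
  hence mono: "strict_mono s" by (simp add: strict_mono_Suc_iff)
  define K where "K j = {thresh (s j)..<thresh (Suc (s j))}" for j
  have "K i \<inter> K j = {}" if "i < j" for i j
    using thresh_mono[of "Suc (s i)" "s j"] strict_monoD[OF mono that] by (auto simp: K_def)
  hence disj: "disjoint_family K"
    unfolding disjoint_family_on_def by (metis Int_commute nat_neq_iff)
  \<comment> \<open>Independence of blocks is stated for the family restricted to each block; the
    restriction disappears under the bounded quantifier.\<close>
  have "indep_events (\<lambda>j. {\<omega> \<in> space M. \<forall>i\<in>K j. restrict (\<lambda>i. X i \<omega>) (K j) i \<le> s j}) UNIV"
    by (rule indep_eventsI_indep_vars[OF indep_vars_restrict[OF indep _ disj]]) (auto simp: K_def)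
  hence ind: "indep_events (\<lambda>j. {\<omega> \<in> space M. \<forall>i\<in>K j. X i \<omega> \<le> s j}) UNIV"
    by (simp cong: ball_cong)
  \<comment> \<open>A block has at most 2/t observations, each at most \<open>s j\<close> with
    probability 1 - t >= exp(-2t); hence the constant exp(-4).\<close>
  have lower: "exp (-4) \<le> prob {\<omega> \<in> space M. \<forall>i\<in>K j. X i \<omega> \<le> s j}" for j
  proof -
    define t where "t = T (Suc (s j))"
    have t: "0 < t" "t \<le> 1/2" using s(2) T_pos by (auto simp: t_def)
    have "- t - 2 * t\<^sup>2 \<le> ln (1 - t)" using t by (intro ln_one_minus_pos_lower_bound) auto
    moreover have "2 * t\<^sup>2 \<le> t" using t by (simp add: power2_eq_square)
    ultimately have "exp (- 2 * t) \<le> 1 - t"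
      using t by (subst ln_ge_iff[symmetric]) auto
    hence "exp (- 2 * t) ^ card (K j) \<le> (1 - t) ^ card (K j)" by (intro power_mono) auto
    moreover have "exp (-4) \<le> exp (- 2 * t) ^ card (K j)"
    proof -
      have "real (card (K j)) \<le> 2 / t"
        using thresh_le[of "Suc (s j)"] by (simp add: K_def t_def)
      hence "t * card (K j) \<le> 2" using t by (simp add: field_simps)
      thus ?thesis by (simp add: exp_of_nat_mult[symmetric] mult_ac)
    qed
    moreover have "{\<omega> \<in> space M. \<forall>i\<in>K j. X i \<omega> \<le> s j} = {\<omega> \<in> space M. \<forall>i\<in>K j. X i \<omega> < Suc (s j)}"
      by auto
    ultimately show ?thesis
      using prob_all_less[of "K j" "Suc (s j)"] by (simp add: K_def t_def)
  qed
  have "\<not> summable (\<lambda>j. prob {\<omega> \<in> space M. \<forall>i\<in>K j. X i \<omega> \<le> s j})"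
  proof
    assume "summable (\<lambda>j. prob {\<omega> \<in> space M. \<forall>i\<in>K j. X i \<omega> \<le> s j})"
    from LIMSEQ_le_const[OF summable_LIMSEQ_zero[OF this], of "exp (-4)"] lower
    show False by auto
  qed
  with ind have block: "AE \<omega> in M. \<exists>\<^sub>\<infinity>j. \<forall>i\<in>K j. X i \<omega> \<le> s j"
    by (rule borel_cantelli_AE2)
  \<comment> \<open>Union bound: at most 2 / \<open>T (s j)\<close> early observations, each
    exceeding \<open>s j\<close> with probability \<open>T (Suc (s j))\<close>, give at most
    \<open>2 * q (s j)\<close>.\<close>
  have upper: "prob {\<omega> \<in> space M. \<exists>i\<in>{..<thresh (s j)}. Suc (s j) \<le> X i \<omega>} \<le> 2 * (1/2) ^ j" for j
  proof -
    have "{\<omega> \<in> space M. \<exists>i\<in>{..<thresh (s j)}. Suc (s j) \<le> X i \<omega>}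
        = (\<Union>i<thresh (s j). {\<omega> \<in> space M. Suc (s j) \<le> X i \<omega>})" by auto
    also have "prob \<dots> \<le> (\<Sum>i<thresh (s j). prob {\<omega> \<in> space M. Suc (s j) \<le> X i \<omega>})"
      by (intro finite_measure_subadditive_finite) auto
    also have "\<dots> = real (thresh (s j)) * T (Suc (s j))" by (simp add: prob_ge)
    also have "\<dots> \<le> 2 / T (s j) * T (Suc (s j))"
      using thresh_le[of "s j"] by (intro mult_right_mono) (auto simp: T_pos less_imp_le)
    also have "\<dots> = 2 * q (s j)" by (simp add: q_def)
    also have "\<dots> \<le> 2 * (1/2) ^ j" using s(1)[of j] by simp
    finally show ?thesis .
  qed
  have "summable (\<lambda>j. 2 * (1/2::real) ^ j)" by (intro summable_mult summable_geometric) simp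
  hence "summable (\<lambda>j. prob {\<omega> \<in> space M. \<exists>i\<in>{..<thresh (s j)}. Suc (s j) \<le> X i \<omega>})"
    by (rule summable_comparison_test'[where N = 0]) (use upper in simp)
  hence "AE \<omega> in M. eventually (\<lambda>j. \<not> (\<exists>i\<in>{..<thresh (s j)}. Suc (s j) \<le> X i \<omega>)) sequentially"
    by (intro borel_cantelli_AE1_pred) auto
  with block show ?thesis
  proof eventually_elim
    case (elim \<omega>)
    from elim(2) obtain J where J: "\<And>i j. j \<ge> J \<Longrightarrow> i < thresh (s j) \<Longrightarrow> X i \<omega> \<le> s j"
      by (auto simp: eventually_at_top_linorder not_le less_Suc_eq_le)
    show ?case
      unfolding INFM_nat_le
    proof
      fix N
      obtain j where j: "j \<ge> max N J" "\<forall>i\<in>K j. X i \<omega> \<le> s j"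
        using elim(1) unfolding INFM_nat_le by blast
      have "X i \<omega> \<le> s j" if "i < thresh (Suc (s j))" for i
        using J[of j i] j that by (cases "i < thresh (s j)") (auto simp: K_def)
      moreover have "N \<le> s j" using strict_mono_imp_increasing[OF mono, of j] j by simp
      ultimately show "\<exists>k\<ge>N. \<forall>i<thresh (Suc k). X i \<omega> \<le> k" by blast
    qed
  qed
qed

end

section \<open>From path properties to the probabilities in the theorem\<close>

lemma Limsup_eq_attained:
  fixes f :: "nat \<Rightarrow> real"
  assumes "eventually (\<lambda>n. f n \<le> c) sequentially" "\<exists>\<^sub>\<infinity>n. f n = c"
  shows "limsup (\<lambda>n. ereal (f n)) = ereal c"
proof (rule antisym)
  show "limsup (\<lambda>n. ereal (f n)) \<le> ereal c"
    using assms(1) by (intro Limsup_bounded) simp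
  show "ereal c \<le> limsup (\<lambda>n. ereal (f n))"
    unfolding limsup_INF_SUP
  proof (intro INF_greatest)
    fix N
    obtain n where "n \<ge> N" "f n = c" using assms(2) by (auto simp: INFM_nat_le)
    thus "ereal c \<le> (SUP n\<in>{N..}. ereal (f n))" by (intro SUP_upper2[of n]) auto
  qed
qed

lemma Liminf_eq_attained:
  fixes f :: "nat \<Rightarrow> real"
  assumes "eventually (\<lambda>n. c \<le> f n) sequentially" "\<exists>\<^sub>\<infinity>n. f n = c"
  shows "liminf (\<lambda>n. ereal (f n)) = ereal c"
  using Limsup_eq_attained[of "\<lambda>n. - f n" "- c"] assms ereal_Limsup_uminus[of sequentially "\<lambda>n. ereal (f n)"]
  by (simp add: ereal_uminus_eq_reorder[symmetric])

theorem corollary1: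
  fixes M :: "'a measure" and \<xi> :: "nat \<Rightarrow> 'a \<Rightarrow> nat" and p :: "nat \<Rightarrow> real" and m :: nat
  assumes "prob_space M"
    and indep: "prob_space.indep_vars M (\<lambda>_. count_space UNIV) \<xi> {1..}"
    and distr: "\<And>n i. n \<ge> 1 \<Longrightarrow> \<P>(\<omega> in M. \<xi> n \<omega> = i) = p i"
    and p_pos: "\<And>i. p i > 0"
    and p_sum: "p sums 1"
    and m: "m \<ge> 1"
    and mono: "mono_on {1..} (log_tail_step p) \<or> antimono_on {1..} (log_tail_step p)"
    and lim: "filterlim (log_tail_step p) at_top sequentially"
    and conv: "summable (\<lambda>k. exp (- real m * log_tail_step p (Suc k)))"
    and div: "\<not> summable (\<lambda>k. exp (- (real m - 1) * log_tail_step p (Suc k)))"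
  shows "\<P>(\<omega> in M. limsup (\<lambda>n. ereal (real (running_max \<xi> n \<omega>) - real (tail_level p n)))
                     = ereal (real m)) = 1
       \<and> \<P>(\<omega> in M. liminf (\<lambda>n. ereal (real (running_max \<xi> n \<omega>) - real (tail_level p n)))
                     = - 1) = 1
       \<and> (\<forall>l \<in> {-1..int m}.
            \<P>(\<omega> in M. \<exists>\<^sub>\<infinity>n. int (running_max \<xi> n \<omega>) = int (tail_level p n) + l) = 1)"
proof -
  interpret prob_space M by fact
  have [measurable]: "\<xi> (Suc i) \<in> measurable M (count_space UNIV)" for i
    using indep by (simp add: indep_vars_def)
  define T where "T = tail p"
  have T_eq: "T k = 1 - (\<Sum>i<k. p i)" for k
  proof -
    have "(p has_sum 1) UNIV"
      using p_sum p_pos by (intro sums_nonneg_imp_has_sum) (auto intro: less_imp_le)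
    moreover have "(p has_sum (\<Sum>i<k. p i)) {..<k}" by (intro has_sum_finite) auto
    ultimately have "(p has_sum (1 - (\<Sum>i<k. p i))) (UNIV - {..<k})"
      by (rule has_sum_Diff) auto
    moreover have "UNIV - {..<k} = {k..}" by auto
    ultimately show ?thesis unfolding T_def tail_def by (metis infsumI)
  qed
  have T_Suc: "T (Suc k) = T k - p k" for k by (simp add: T_eq)
  have T_lim: "T \<longlonglongrightarrow> 0"
    using tendsto_diff[OF tendsto_const[of "1::real"] p_sum[unfolded sums_def]]
    by (simp add: T_eq[abs_def])
  have T_dec: "decseq T" by (rule decseq_SucI) (use p_pos in \<open>simp add: T_Suc less_imp_le\<close>)
  have T_pos: "T k > 0" for k
    using decseq_ge[OF T_dec T_lim, of "Suc k"] p_pos[of k] by (simp add: T_Suc)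
  have step: "log_tail_step p (Suc k) = - ln (T (Suc k) / T k)" for k
    using T_pos[of k] T_pos[of "Suc k"]
    by (simp add: log_tail_step_def log_tail_def T_def[symmetric] ln_div)
  have ratio: "T (Suc k) / T k = exp (- log_tail_step p (Suc k))" for k
    using T_pos[of k] T_pos[of "Suc k"] by (simp add: step)
  \<comment> \<open>A decreasing step function would stay below its value at 1, contrary to its
    divergence to infinity.\<close>
  have mono': "mono_on {1..} (log_tail_step p)"
  proof (rule ccontr)
    assume "\<not> ?thesis"
    hence anti: "antimono_on {1..} (log_tail_step p)" using mono by blast
    have "eventually (\<lambda>k. k \<ge> 1 \<and> log_tail_step p 1 + 1 \<le> log_tail_step p k) sequentially"
      using lim by (auto simp: filterlim_at_top intro!: eventually_conj eventually_ge_at_top)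
    then obtain k where "k \<ge> 1" "log_tail_step p 1 + 1 \<le> log_tail_step p k"
      using eventually_happens'[of sequentially] by auto
    thus False using monotone_onD[OF anti, of 1 k] by simp
  qed
  interpret tail_function T
  proof
    show "T 0 = 1" by (simp add: T_eq)
    show "T k > 0" "T (Suc k) < T k" for k using T_pos p_pos by (auto simp: T_Suc)
    show "T \<longlonglongrightarrow> 0" by (rule T_lim)
    show "decseq (\<lambda>k. T (Suc k) / T k)"
    proof (rule decseq_SucI)
      fix k
      have "log_tail_step p (Suc k) \<le> log_tail_step p (Suc (Suc k))"
        by (rule monotone_onD[OF mono']) auto
      thus "T (Suc (Suc k)) / T (Suc k) \<le> T (Suc k) / T k" by (simp add: ratio)
    qed
    have "filterlim (\<lambda>k. log_tail_step p (Suc k)) at_top sequentially"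
      by (rule filterlim_compose[OF lim filterlim_Suc])
    hence "filterlim (\<lambda>k. - log_tail_step p (Suc k)) at_bot sequentially"
      by (simp add: filterlim_uminus_at_bot)
    thus "(\<lambda>k. T (Suc k) / T k) \<longlonglongrightarrow> 0"
      unfolding ratio by (rule filterlim_compose[OF exp_at_bot])
  qed
  have q_pow: "q k ^ j = exp (- real j * log_tail_step p (Suc k))" for k j
    by (simp add: q_def ratio exp_of_nat_mult[symmetric])
  have conv': "summable (\<lambda>k. q k ^ m)" using conv by (simp add: q_pow)
  have div': "\<not> summable (\<lambda>k. q k ^ (m - 1))" using div m by (simp add: q_pow of_nat_diff)
  define X where "X i = \<xi> (Suc i)" for i
  interpret iid_tail M T X
  proof
    have "range Suc = {1..}" by (auto simp: image_iff Suc_le_eq gr0_conv_Suc)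
    thus "indep_vars (\<lambda>_. count_space UNIV) X UNIV"
      unfolding X_def using indep by (intro indep_vars_reindex[of Suc]) auto
    show "prob {\<omega> \<in> space M. k \<le> X i \<omega>} = T k" for k i
    proof -
      have "prob {\<omega> \<in> space M. X i \<omega> < k} = prob (\<Union>j<k. {\<omega> \<in> space M. X i \<omega> = j})"
        by (intro arg_cong[where f = prob]) auto
      also have "\<dots> = (\<Sum>j<k. prob {\<omega> \<in> space M. X i \<omega> = j})"
        by (intro finite_measure_finite_Union) (auto simp: disjoint_family_on_def X_def)
      also have "\<dots> = (\<Sum>j<k. p j)" by (simp add: X_def distr)
      finally have "prob {\<omega> \<in> space M. \<not> X i \<omega> < k} = T k"
        by (subst prob_neg) (auto simp: X_def T_eq)
      thus ?thesis by (simp add: not_less)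
    qed
  qed
  have level: "tail_level p = level" by (simp add: fun_eq_iff tail_level_def level_def flip: T_def)
  have rmax: "running_max \<xi> n \<omega> = Max ((\<lambda>i. X i \<omega>) ` {..<n})" for n \<omega>
  proof -
    have "{1..n} = Suc ` {..<n}" by (simp add: image_Suc_lessThan)
    thus ?thesis by (simp add: running_max_def X_def image_image)
  qed
  \<comment> \<open>Measurability makes probability 1 equivalent to holding almost everywhere. It is
    checked on singletons; for n = 0 the function is the constant \<open>Max {}\<close>.\<close>
  have meas [measurable]: "running_max \<xi> n \<in> measurable M (count_space UNIV)" for n
  proof (cases "n = 0")
    case False
    have "running_max \<xi> n \<omega> = k \<longleftrightarrow> (\<exists>i\<in>{..<n}. X i \<omega> = k) \<and> (\<forall>i\<in>{..<n}. X i \<omega> \<le> k)" for k \<omega>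
      unfolding rmax using False by (subst Max_eq_iff) (auto simp: lessThan_empty_iff)
    hence "running_max \<xi> n -` {k} \<inter> space M
      = {\<omega> \<in> space M. (\<exists>i\<in>{..<n}. X i \<omega> = k) \<and> (\<forall>i\<in>{..<n}. X i \<omega> \<le> k)}" for k by auto
    thus ?thesis by (subst measurable_count_space_eq2_countable) auto
  qed (simp add: running_max_def[abs_def])
  \<comment> \<open>Outside a null set all four path properties hold at once, so the deterministic
    argument applies simultaneously for every l.\<close>
  have path: "AE \<omega> in M. eventually (\<lambda>n. int (running_max \<xi> n \<omega>) - int (level n) \<le> int m) sequentially
     \<and> eventually (\<lambda>n. int (running_max \<xi> n \<omega>) - int (level n) \<ge> -1) sequentially
     \<and> (\<forall>l\<in>{-1..int m}. \<exists>\<^sub>\<infinity>n. int (running_max \<xi> n \<omega>) - int (level n) = l)"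
    using AE_upper[OF conv'] AE_upper_attained[OF div' m] AE_lower[OF conv' m] AE_lower_attained
  proof eventually_elim
    case (elim \<omega>)
    show ?case using max_minus_level[OF elim] unfolding rmax by blast
  qed
  show ?thesis
    unfolding level
  proof (intro conjI ballI)
    show "prob {\<omega> \<in> space M. limsup (\<lambda>n. ereal (real (running_max \<xi> n \<omega>) - real (level n))) = ereal (real m)} = 1"
    proof (subst prob_Collect_eq_1)
      show "AE \<omega> in M. limsup (\<lambda>n. ereal (real (running_max \<xi> n \<omega>) - real (level n))) = ereal (real m)"
        using path
      proof eventually_elim
        case (elim \<omega>)
        hence "\<exists>\<^sub>\<infinity>n. int (running_max \<xi> n \<omega>) - int (level n) = int m" by auto
        hence "\<exists>\<^sub>\<infinity>n. real (running_max \<xi> n \<omega>) - real (level n) = real m"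
          by (rule INFM_mono) linarith
        moreover have "eventually (\<lambda>n. real (running_max \<xi> n \<omega>) - real (level n) \<le> real m) sequentially"
          using elim[THEN conjunct1] by (rule eventually_mono) linarith
        ultimately show ?case by (intro Limsup_eq_attained)
      qed
    qed measurable
    show "prob {\<omega> \<in> space M. liminf (\<lambda>n. ereal (real (running_max \<xi> n \<omega>) - real (level n))) = - 1} = 1"
    proof (subst prob_Collect_eq_1)
      show "AE \<omega> in M. liminf (\<lambda>n. ereal (real (running_max \<xi> n \<omega>) - real (level n))) = - 1"
        using path
      proof eventually_elim
        case (elim \<omega>)
        hence "\<exists>\<^sub>\<infinity>n. int (running_max \<xi> n \<omega>) - int (level n) = -1" by auto
        hence "\<exists>\<^sub>\<infinity>n. real (running_max \<xi> n \<omega>) - real (level n) = -1"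
          by (rule INFM_mono) linarith
        moreover have "eventually (\<lambda>n. -1 \<le> real (running_max \<xi> n \<omega>) - real (level n)) sequentially"
          using elim[THEN conjunct2, THEN conjunct1] by (rule eventually_mono) linarith
        ultimately show ?case by (subst Liminf_eq_attained) (auto simp: one_ereal_def)
      qed
    qed measurable
    show "prob {\<omega> \<in> space M. \<exists>\<^sub>\<infinity>n. int (running_max \<xi> n \<omega>) = int (level n) + l} = 1"
      if "l \<in> {-1..int m}" for l
    proof (subst prob_Collect_eq_1)
      show "AE \<omega> in M. \<exists>\<^sub>\<infinity>n. int (running_max \<xi> n \<omega>) = int (level n) + l"
        using path by eventually_elim (use that in \<open>auto simp: algebra_simps\<close>)
    qed (unfold INFM_nat_le, measurable)
  qed
qed

end
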